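(* Let $d\ge 2$, $\Omega=\{1,\dots,d\}^{\mathbb{N}}$, and let $A:\Omega\to\mathbb{R}$ be a Lipschitz potential which is normalized, i.e. $\sum_{i=1}^d e^{A(iz)}=1$ for all $z\in\Omega$. Let $\mu_A$ be the Gibbs measure of $A$. Choose any $z_0\in\Omega$ and define a random sequence $(z_k)_{k\ge 0}$ in $\Omega$ by recurrence: given $z_k$, $$z_{k+1}=iz_k \quad\text{with probability}\quad p_i(z_k)=e^{A(iz_k)},\qquad i=1,\dots,d.$$ Then, for any continuous function $f:\Omega\to\mathbb{R}$, $$\frac1N\sum_{k=0}^{N-1}f(z_k)\longrightarrow \int_\Omega f\,d\mu_A \quad (N\to\infty)$$ with probability one.
   Context: $\Omega=\{1,\dots,d\}^{\mathbb{N}}$ is the Bernoulli space on $d$ symbols, a compact metric space with a usual metric $d_\theta(y,w)=\theta^{\min\{k:\,y_k\neq w_k\}}$ for a fixed $0<\theta<1$ (and $d_\theta(y,y)=0$), with its Borel $\sigma$-algebra; $T:\Omega\to\Omega$ is the shift map. For $z=(z_1,z_2,\dots)\in\Omega$ and $i\in\{1,\dots,d\}$, $iz=(i,z_1,z_2,\dots)$. The Ruelle-Perron-Frobenius operator of $A$ is $L_A(\varphi)(z)=\sum_{T(w)=z}e^{A(w)}\varphi(w)$ for continuous $\varphi:\Omega\to\mathbb{R}$. Its dual $L_A^*$ acts on probability measures by $\int\psi\,dL_A^*(\mu)=\int L_A(\psi)\,d\mu$. For a normalized Lipschitz potential $A$ (i.e. $L_A(1)=1$), the Gibbs measure $\mu_A$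 is the unique Borel probability measure on $\Omega$ with $L_A^*(\mu_A)=\mu_A$. The random sequence is the Markov process on $\Omega$ started at the deterministic point $z_0$ with the stated transition probabilities. "With probability one" refers to the law of the random address sequence $(i_1,i_2,\dots)\in\{1,\dots,d\}^{\mathbb{N}}$, where $z_{k+1}=i_{k+1}z_k$; this law gives the cylinder $(i_1,\dots,i_k)$ the probability $p_{i_1}(z_0)\,p_{i_2}(z_1)\cdots p_{i_k}(z_{k-1})$. *)

theory Defs
  imports "HOL-Probability.Probability"
begin

text \<open>
  A sequence \<open>(y\<^sub>1, y\<^sub>2, \<dots>)\<close> is a function \<open>y :: nat \<Rightarrow> nat\<close> whose value at \<open>k\<close> is
  the coordinate \<open>y\<^sub>k\<^sub>+\<^sub>1\<close>.  Functions on the Bernoulli space are total functions on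
  \<open>nat \<Rightarrow> nat\<close> of which only the values on \<open>bernoulli_space d\<close> matter.
\<close>

definition bernoulli_space :: "nat \<Rightarrow> (nat \<Rightarrow> nat) set" where
  "bernoulli_space d = {y. \<forall>k. y k \<in> {1..d}}"

text \<open>
  The \<open>Suc\<close> accounts for the first coordinate being stored at position \<open>0\<close>, so the
  exponent is the least \<open>k \<ge> 1\<close> with \<open>y\<^sub>k \<noteq> w\<^sub>k\<close>.
\<close>

definition shift_dist :: "real \<Rightarrow> (nat \<Rightarrow> nat) \<Rightarrow> (nat \<Rightarrow> nat) \<Rightarrow> real" where
  "shift_dist \<theta> y w = (if y = w then 0 else \<theta> ^ Suc (LEAST k. y k \<noteq> w k))"

definition shift_metric :: "real \<Rightarrow> nat \<Rightarrow> (nat \<Rightarrow> nat) metric" where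
  "shift_metric \<theta> d = metric (bernoulli_space d, shift_dist \<theta>)"

lemma Metric_space_shift_dist:
  assumes "0 < \<theta>" "\<theta> < 1"
  shows "Metric_space (bernoulli_space d) (shift_dist \<theta>)"
proof
  fix x y z :: "nat \<Rightarrow> nat"
  show "0 \<le> shift_dist \<theta> x y"
    using assms by (simp add: shift_dist_def)
  show "shift_dist \<theta> x y = shift_dist \<theta> y x"
  proof -
    have "(\<lambda>k. x k \<noteq> y k) = (\<lambda>k. y k \<noteq> x k)" by auto
    then show ?thesis by (simp add: shift_dist_def)
  qed
  show "shift_dist \<theta> x y = 0 \<longleftrightarrow> x = y"
    using assms by (simp add: shift_dist_def)
  show "shift_dist \<theta> x z \<le> shift_dist \<theta> x y + shift_dist \<theta> y z"
  proof (cases "x = z \<or> x = y \<or> y = z")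
    case True
    then show ?thesis
      using assms by (auto simp: shift_dist_def)
  next
    case False
    define m where "m = (LEAST k. x k \<noteq> z k)"
    have "\<exists>k. x k \<noteq> z k" using False by auto
    then have "x m \<noteq> z m" unfolding m_def by (rule LeastI_ex)
    then consider "x m \<noteq> y m" | "y m \<noteq> z m" by metis
    then show ?thesis
    proof cases
      case 1
      then have "(LEAST k. x k \<noteq> y k) \<le> m" by (rule Least_le)
      then have "\<theta> ^ Suc m \<le> \<theta> ^ Suc (LEAST k. x k \<noteq> y k)"
        using assms by (intro power_decreasing) auto
      then show ?thesis
        using False assms by (simp add: shift_dist_def m_def add_increasing2)
    next
      case 2
      then have "(LEAST k. y k \<noteq> z k) \<le> m" by (rule Least_le)
      then have "\<theta> ^ Suc m \<le> \<theta> ^ Suc (LEAST k. y k \<noteq> z k)"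
        using assms by (intro power_decreasing) auto
      then show ?thesis
        using False assms by (simp add: shift_dist_def m_def add_increasing)
    qed
  qed
qed

lemma
  assumes "0 < \<theta>" "\<theta> < 1"
  shows mspace_shift_metric: "mspace (shift_metric \<theta> d) = bernoulli_space d"
    and mdist_shift_metric: "mdist (shift_metric \<theta> d) = shift_dist \<theta>"
  using Metric_space_shift_dist[OF assms]
  by (simp_all add: shift_metric_def Metric_space.mspace_metric Metric_space.mdist_metric)

definition borel_mspace :: "'a metric \<Rightarrow> 'a measure" where
  "borel_mspace m = sigma (mspace m) {U. openin (mtopology_of m) U}"

definition borel_prob :: "'a metric \<Rightarrow> 'a measure \<Rightarrow> bool" where
  "borel_prob m \<mu> \<longleftrightarrow> prob_space \<mu> \<and> sets \<mu> = sets (borel_mspace m)"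

definition continuous_fun :: "'a metric \<Rightarrow> ('a \<Rightarrow> real) \<Rightarrow> bool" where
  "continuous_fun m f \<longleftrightarrow> continuous_map (mtopology_of m) euclideanreal f"

definition shift :: "(nat \<Rightarrow> nat) \<Rightarrow> nat \<Rightarrow> nat" where
  "shift w = (\<lambda>k. w (Suc k))"

definition scons :: "nat \<Rightarrow> (nat \<Rightarrow> nat) \<Rightarrow> nat \<Rightarrow> nat" where
  "scons i z = case_nat i z"

definition ruelle_operator ::
    "nat \<Rightarrow> ((nat \<Rightarrow> nat) \<Rightarrow> real) \<Rightarrow> ((nat \<Rightarrow> nat) \<Rightarrow> real) \<Rightarrow> (nat \<Rightarrow> nat) \<Rightarrow> real" where
  "ruelle_operator d A \<phi> z = (\<Sum>w | w \<in> bernoulli_space d \<and> shift w = z. exp (A w) * \<phi> w)"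

definition normalized :: "nat \<Rightarrow> ((nat \<Rightarrow> nat) \<Rightarrow> real) \<Rightarrow> bool" where
  "normalized d A \<longleftrightarrow> (\<forall>z\<in>bernoulli_space d. (\<Sum>i=1..d. exp (A (scons i z))) = 1)"

text \<open>\<open>is_dual_image \<theta> d A \<mu> \<nu>\<close> says that the dual operator maps \<open>\<mu>\<close> to \<open>\<nu>\<close>.\<close>

definition is_dual_image ::
    "real \<Rightarrow> nat \<Rightarrow> ((nat \<Rightarrow> nat) \<Rightarrow> real) \<Rightarrow> (nat \<Rightarrow> nat) measure \<Rightarrow> (nat \<Rightarrow> nat) measure \<Rightarrow> bool" where
  "is_dual_image \<theta> d A \<mu> \<nu> \<longleftrightarrow>
     borel_prob (shift_metric \<theta> d) \<mu> \<and> borel_prob (shift_metric \<theta> d) \<nu> \<and>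
     (\<forall>\<psi>. continuous_fun (shift_metric \<theta> d) \<psi> \<longrightarrow>
        (\<integral>x. \<psi> x \<partial>\<nu>) = (\<integral>x. ruelle_operator d A \<psi> x \<partial>\<mu>))"

text \<open>
  For a normalized Lipschitz potential \<open>A\<close> exactly one measure has this property.
\<close>

definition gibbs_measure ::
    "real \<Rightarrow> nat \<Rightarrow> ((nat \<Rightarrow> nat) \<Rightarrow> real) \<Rightarrow> (nat \<Rightarrow> nat) measure \<Rightarrow> bool" where
  "gibbs_measure \<theta> d A \<mu> \<longleftrightarrow> is_dual_image \<theta> d A \<mu> \<mu>"

definition trans_prob :: "((nat \<Rightarrow> nat) \<Rightarrow> real) \<Rightarrow> nat \<Rightarrow> (nat \<Rightarrow> nat) \<Rightarrow> real" where
  "trans_prob A i z = exp (A (scons i z))"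

text \<open>
  The points \<open>z\<^sub>k\<close> as functions of the address sequence \<open>\<omega> = (i\<^sub>1, i\<^sub>2, \<dots>)\<close>; note that
  \<open>i\<^sub>k\<^sub>+\<^sub>1\<close> is \<open>\<omega> k\<close>.
\<close>

primrec orbit :: "(nat \<Rightarrow> nat) \<Rightarrow> (nat \<Rightarrow> nat) \<Rightarrow> nat \<Rightarrow> nat \<Rightarrow> nat" where
  "orbit z\<^sub>0 \<omega> 0 = z\<^sub>0"
| "orbit z\<^sub>0 \<omega> (Suc k) = scons (\<omega> k) (orbit z\<^sub>0 \<omega> k)"

text \<open>
  The law of the address sequence of the process started at \<open>z\<^sub>0\<close>, determined by the
  probabilities of the cylinders \<open>(i\<^sub>1, \<dots>, i\<^sub>k)\<close>, each given by a sequence \<open>i\<close> of which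
  only the first \<open>k\<close> entries matter.
\<close>

definition address_law ::
    "real \<Rightarrow> nat \<Rightarrow> ((nat \<Rightarrow> nat) \<Rightarrow> real) \<Rightarrow> (nat \<Rightarrow> nat) \<Rightarrow> (nat \<Rightarrow> nat) measure \<Rightarrow> bool" where
  "address_law \<theta> d A z\<^sub>0 P \<longleftrightarrow>
     borel_prob (shift_metric \<theta> d) P \<and>
     (\<forall>i\<in>bernoulli_space d. \<forall>k.
        measure P {\<omega> \<in> bernoulli_space d. \<forall>j<k. \<omega> j = i j}
          = (\<Prod>j<k. trans_prob A (i j) (orbit z\<^sub>0 i j)))"

end

theory Submission
  imports Defs
begin

text \<open>
  Write \<open>L\<close> for the transfer operator of \<open>A\<close> and \<open>w\<close> for an address of length \<open>n\<close>.  Since \<open>A\<close> is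
  normalized, the numbers \<open>weight A z n w\<close> are the probabilities of the addresses seen from the
  point \<open>z\<close>, and \<open>(L\<^sup>n f) z\<close> is the mean of \<open>f\<close> over the corresponding endpoints.  The proof
  combines two facts.

  \<^item> Let \<open>f\<close> be continuous.  Then \<open>L\<^sup>n f\<close> converges uniformly to the constant \<open>\<integral> f d\<mu>\<close>.  Because \<open>A\<close>
    is Lipschitz, the ratio of the weights of an address seen from two points is at least some
    \<open>\<delta> > 0\<close> that does not depend on the length (\<open>weight_distortion\<close>).  Hence \<open>L\<^sup>n\<close> multiplies
    the oscillation of \<open>f\<close> by at most \<open>1 - \<delta>\<close>, up to the variation of \<open>f\<close> on cylinders of length \<open>n\<close>
    (\<open>oscillation_contraction\<close>), which is small since the shift space is compact.  By iteration,
    the oscillation of \<open>L\<^sup>n f\<close> tends to \<open>0\<close>, and the integral of \<open>L\<^sup>n f\<close> with respect to \<open>\<mu>\<close> is that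
    of \<open>f\<close>.

  \<^item> The differences \<open>f (z\<^sub>k\<^sub>+\<^sub>1) - (L f) (z\<^sub>k)\<close> are bounded and have conditional mean \<open>0\<close>, so their
    averages tend to \<open>0\<close> almost surely.  This is proved by bounding the exponential moments of the
    sums (\<open>exponential_moment\<close>) and applying the Borel--Cantelli lemma (\<open>martingale_averages\<close>).

  Shifting the index by one changes an average of a bounded sequence by a vanishing amount, so by
  the second fact the averages of \<open>f\<close> and of \<open>L f\<close> along the orbit almost surely differ by a null
  sequence, and inductively so do those of \<open>f\<close> and of \<open>L\<^sup>n f\<close> for every \<open>n\<close>.  By the first fact
  the latter are, for large \<open>n\<close>, uniformly close to \<open>\<integral> f d\<mu>\<close>.
\<close>

section \<open>Topology of the shift space\<close>

locale shift_space =
  fixes \<theta> :: real and d :: nat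
  assumes theta_pos: "0 < \<theta>" and theta_less_1: "\<theta> < 1" and d_pos: "1 \<le> d"
begin

abbreviation \<Omega> :: "(nat \<Rightarrow> nat) set" where
  "\<Omega> \<equiv> bernoulli_space d"

abbreviation top\<^sub>\<Omega> :: "(nat \<Rightarrow> nat) topology" where
  "top\<^sub>\<Omega> \<equiv> mtopology_of (shift_metric \<theta> d)"

sublocale Metric_space \<Omega> "shift_dist \<theta>"
  by (rule Metric_space_shift_dist[OF theta_pos theta_less_1])

lemma mtopology_of_shift_metric: "top\<^sub>\<Omega> = mtopology"
  using theta_pos theta_less_1
  by (simp add: mtopology_of_def mspace_shift_metric mdist_shift_metric)

lemma topspace_shift [simp]: "topspace top\<^sub>\<Omega> = \<Omega>"
  by (simp add: mtopology_of_shift_metric)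

lemma shift_dist_le:
  assumes "\<And>k. k < n \<Longrightarrow> x k = y k"
  shows "shift_dist \<theta> x y \<le> \<theta> ^ Suc n"
proof (cases "x = y")
  case False
  then have "\<exists>k. x k \<noteq> y k" by auto
  then have "x (LEAST k. x k \<noteq> y k) \<noteq> y (LEAST k. x k \<noteq> y k)"
    by (rule LeastI_ex)
  then have "n \<le> (LEAST k. x k \<noteq> y k)"
    using assms by (meson not_le)
  then have "\<theta> ^ Suc (LEAST k. x k \<noteq> y k) \<le> \<theta> ^ Suc n"
    using theta_pos theta_less_1 by (intro power_decreasing) auto
  then show ?thesis
    using False by (simp only: shift_dist_def if_False)
qed (use theta_pos in \<open>simp add: shift_dist_def\<close>)

lemma shift_dist_less_imp_agree:
  assumes "shift_dist \<theta> x y < \<theta> ^ n" "k < n"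
  shows "x k = y k"
proof (rule ccontr)
  assume neq: "x k \<noteq> y k"
  then have "(LEAST k. x k \<noteq> y k) \<le> k" by (rule Least_le)
  then have "\<theta> ^ n \<le> \<theta> ^ Suc (LEAST k. x k \<noteq> y k)"
    using assms(2) theta_pos theta_less_1 by (intro power_decreasing) auto
  then show False
    using assms(1) neq by (auto simp: shift_dist_def split: if_splits)
qed

text \<open>The cylinder of all sequences that agree with \<open>x\<close> in the first \<open>n\<close> coordinates.\<close>

definition cylinder :: "nat \<Rightarrow> (nat \<Rightarrow> nat) \<Rightarrow> (nat \<Rightarrow> nat) set" where
  "cylinder n x = {y \<in> \<Omega>. \<forall>k<n. y k = x k}"

lemma openin_cylinder: "openin top\<^sub>\<Omega> (cylinder n x)"
  unfolding mtopology_of_shift_metric openin_mtopology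
proof (intro conjI allI impI)
  fix y assume y: "y \<in> cylinder n x"
  have "mball y (\<theta> ^ n) \<subseteq> cylinder n x"
  proof
    fix v assume v: "v \<in> mball y (\<theta> ^ n)"
    then have "y k = v k" if "k < n" for k
      using shift_dist_less_imp_agree[of y v n k] that by (simp only: in_mball simp_thms)
    then show "v \<in> cylinder n x"
      using y v by (simp add: cylinder_def)
  qed
  then show "\<exists>r>0. mball y r \<subseteq> cylinder n x"
    using theta_pos by (meson zero_less_power)
qed (auto simp: cylinder_def)

text \<open>
  Compactness comes from Tychonoff's theorem for the product of finite discrete spaces, whose
  topology is at least as fine as that of the metric.
\<close>

lemma compact_space_shift: "compact_space top\<^sub>\<Omega>"
proof -
  let ?X = "product_topology (\<lambda>_::nat. discrete_topology {1..d}) UNIV"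
  have top: "topspace ?X = \<Omega>"
    by (auto simp: PiE_def bernoulli_space_def)
  have "continuous_map ?X mtopology (\<lambda>x. x)"
    unfolding continuous_map_to_metric
  proof (intro ballI allI impI)
    fix x :: "nat \<Rightarrow> nat" and \<epsilon> :: real
    assume "x \<in> topspace ?X" and "\<epsilon> > 0"
    then have x: "x \<in> \<Omega>" using top by simp
    obtain n where n: "\<theta> ^ n < \<epsilon>"
      using real_arch_pow_inv[OF \<open>\<epsilon> > 0\<close> theta_less_1] by blast
    have "cylinder n x = PiE UNIV (\<lambda>k. if k < n then {x k} else {1..d})"
      using x by (force simp: cylinder_def bernoulli_space_def PiE_def Pi_def split: if_splits)
    moreover have "openin ?X (PiE UNIV (\<lambda>k. if k < n then {x k} else {1..d}))"
      unfolding openin_PiE_gen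
    proof (intro disjI2 conjI)
      show "finite {k \<in> UNIV. (if k < n then {x k} else {1..d}) \<noteq> topspace (discrete_topology {1..d})}"
        by (rule finite_subset[of _ "{..<n}"]) (auto split: if_splits)
      show "\<forall>k\<in>UNIV. openin (discrete_topology {1..d}) (if k < n then {x k} else {1..d})"
        using x by (auto simp: bernoulli_space_def)
    qed
    moreover have "y \<in> mball x \<epsilon>" if "y \<in> cylinder n x" for y
    proof -
      have "shift_dist \<theta> x y \<le> \<theta> ^ Suc n"
        using that by (intro shift_dist_le) (auto simp: cylinder_def)
      also have "\<dots> \<le> \<theta> ^ n"
        using theta_pos theta_less_1 by (intro power_decreasing) auto
      also have "\<dots> < \<epsilon>" by (rule n)
      finally show ?thesis
        using x that by (simp add: cylinder_def)
    qed
    ultimately show "\<exists>U. openin ?X U \<and> x \<in> U \<and> (\<forall>y\<in>U. y \<in> mball x \<epsilon>)"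
      using x by (intro exI[of _ "cylinder n x"]) (auto simp: cylinder_def)
  qed
  moreover have "compactin ?X \<Omega>"
    using compact_space_product_topology[of "\<lambda>_::nat. discrete_topology {1..d}" UNIV] top
    by (simp add: compact_space_def compactin_discrete_topology)
  ultimately have "compactin mtopology ((\<lambda>x. x) ` \<Omega>)"
    by (rule image_compactin[rotated])
  then show ?thesis
    by (simp add: mtopology_of_shift_metric compact_space_def)
qed

lemma continuous_fun_uniform:
  assumes "continuous_fun (shift_metric \<theta> d) f" "\<epsilon> > 0"
  obtains n where "\<And>x y. \<lbrakk>x \<in> \<Omega>; y \<in> \<Omega>; \<And>k. k < n \<Longrightarrow> x k = y k\<rbrakk> \<Longrightarrow> \<bar>f x - f y\<bar> < \<epsilon>"
proof -
  have "uniformly_continuous_map (shift_metric \<theta> d) euclidean_metric f"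
    using assms(1) continuous_eq_uniformly_continuous_map[OF compact_space_shift, of euclidean_metric f]
    by (simp add: continuous_fun_def)
  then obtain r where r: "r > 0"
    "\<And>x y. \<lbrakk>x \<in> \<Omega>; y \<in> \<Omega>; shift_dist \<theta> y x < r\<rbrakk> \<Longrightarrow> \<bar>f y - f x\<bar> < \<epsilon>"
    using assms(2) theta_pos theta_less_1
    unfolding uniformly_continuous_map_def
    by (auto simp: mspace_shift_metric mdist_shift_metric dist_real_def)
  obtain n where n: "\<theta> ^ n < r"
    using real_arch_pow_inv[OF r(1) theta_less_1] by blast
  show ?thesis
  proof
    fix x y assume xy: "x \<in> \<Omega>" "y \<in> \<Omega>" "\<And>k. k < n \<Longrightarrow> x k = y k"
    have "shift_dist \<theta> x y \<le> \<theta> ^ Suc n" using xy(3) by (rule shift_dist_le)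
    also have "\<dots> \<le> \<theta> ^ n"
      using theta_pos theta_less_1 by (intro power_decreasing) auto
    also have "\<dots> < r" by (rule n)
    finally show "\<bar>f x - f y\<bar> < \<epsilon>" by (rule r(2)[OF xy(2,1)])
  qed
qed

lemma continuous_fun_bounded:
  assumes "continuous_fun (shift_metric \<theta> d) f"
  obtains K where "K > 0" "\<And>x. x \<in> \<Omega> \<Longrightarrow> \<bar>f x\<bar> \<le> K"
proof -
  have "compactin top\<^sub>\<Omega> \<Omega>"
    using compact_space_shift unfolding compact_space_def topspace_shift .
  then have "compactin euclideanreal (f ` \<Omega>)"
    using assms unfolding continuous_fun_def by (rule image_compactin)
  then have "bounded (f ` \<Omega>)"
    by (simp add: compact_imp_bounded)
  then show ?thesis
    using that by (auto simp: bounded_pos)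
qed

lemma borel_prob_space:
  assumes "borel_prob (shift_metric \<theta> d) \<nu>"
  shows "space \<nu> = \<Omega>"
proof -
  have "sets \<nu> = sets (borel_mspace (shift_metric \<theta> d))"
    using assms by (simp add: borel_prob_def)
  then have "space \<nu> = space (borel_mspace (shift_metric \<theta> d))"
    by (rule sets_eq_imp_space_eq)
  also have "\<dots> = \<Omega>"
    using theta_pos theta_less_1
    by (simp add: borel_mspace_def space_measure_of_conv mspace_shift_metric)
  finally show ?thesis .
qed

lemma borel_prob_openin:
  assumes "borel_prob (shift_metric \<theta> d) \<nu>" "openin top\<^sub>\<Omega> U"
  shows "U \<in> sets \<nu>"
proof -
  have "{U. openin top\<^sub>\<Omega> U} \<subseteq> Pow (mspace (shift_metric \<theta> d))"
    using openin_subset topspace_mtopology_of by (metis CollectD PowI subsetI)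
  then have "U \<in> sets (borel_mspace (shift_metric \<theta> d))"
    unfolding borel_mspace_def using assms(2) by (intro in_measure_of CollectI)
  then show ?thesis using assms(1) by (simp add: borel_prob_def)
qed

lemma continuous_fun_measurable:
  assumes "borel_prob (shift_metric \<theta> d) \<nu>" "continuous_fun (shift_metric \<theta> d) f"
  shows "f \<in> borel_measurable \<nu>"
proof (rule borel_measurableI)
  fix S :: "real set" assume "open S"
  then have "openin euclideanreal S" by simp
  from openin_continuous_map_preimage[OF assms(2)[unfolded continuous_fun_def] this]
  have "openin top\<^sub>\<Omega> {x \<in> \<Omega>. f x \<in> S}"
    by (simp only: topspace_shift)
  then have "{x \<in> \<Omega>. f x \<in> S} \<in> sets \<nu>"
    by (rule borel_prob_openin[OF assms(1)])
  also have "{x \<in> \<Omega>. f x \<in> S} = f -` S \<inter> space \<nu>"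
    unfolding borel_prob_space[OF assms(1)] by blast
  finally show "f -` S \<inter> space \<nu> \<in> sets \<nu>" .
qed

lemma scons_in [intro]: "i \<in> {1..d} \<Longrightarrow> z \<in> \<Omega> \<Longrightarrow> scons i z \<in> \<Omega>"
  by (auto simp: bernoulli_space_def scons_def split: nat.split)

lemma orbit_in [intro]: "\<omega> \<in> \<Omega> \<Longrightarrow> z \<in> \<Omega> \<Longrightarrow> orbit z \<omega> n \<in> \<Omega>"
  by (induction n) (auto simp: bernoulli_space_def scons_def split: nat.split)

lemma continuous_map_scons:
  assumes "i \<in> {1..d}"
  shows "continuous_map top\<^sub>\<Omega> top\<^sub>\<Omega> (scons i)"
  unfolding mtopology_of_shift_metric continuous_map_to_metric
proof (intro ballI allI impI)
  fix x and \<epsilon> :: real assume "x \<in> topspace mtopology" "\<epsilon> > 0"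
  then have x: "x \<in> \<Omega>" by simp
  obtain n where n: "\<theta> ^ n < \<epsilon>"
    using real_arch_pow_inv[OF \<open>\<epsilon> > 0\<close> theta_less_1] by blast
  have "scons i y \<in> mball (scons i x) \<epsilon>" if "y \<in> cylinder n x" for y
  proof -
    have "shift_dist \<theta> (scons i x) (scons i y) \<le> \<theta> ^ Suc n"
      using that by (intro shift_dist_le) (auto simp: cylinder_def scons_def split: nat.split)
    also have "\<dots> \<le> \<theta> ^ n"
      using theta_pos theta_less_1 by (intro power_decreasing) auto
    also have "\<dots> < \<epsilon>" by (rule n)
    finally show ?thesis
      using scons_in[OF assms] x that by (simp add: cylinder_def)
  qed
  moreover have "openin mtopology (cylinder n x)"
    using openin_cylinder by (simp add: mtopology_of_shift_metric)
  ultimately show "\<exists>U. openin mtopology U \<and> x \<in> U \<and> (\<forall>y\<in>U. scons i y \<in> mball (scons i x) \<epsilon>)"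
    using x by (intro exI[of _ "cylinder n x"]) (auto simp: cylinder_def)
qed

end

section \<open>Finite addresses and their weights\<close>

text \<open>
  Addresses of length \<open>n\<close>, encoded as infinite sequences padded with the symbol \<open>1\<close>.
\<close>

definition addresses :: "nat \<Rightarrow> nat \<Rightarrow> (nat \<Rightarrow> nat) set" where
  "addresses d n = {w \<in> bernoulli_space d. \<forall>k\<ge>n. w k = 1}"

text \<open>
  The probability that the process started at \<open>z\<close> follows the first \<open>n\<close> symbols of \<open>w\<close>.
\<close>

definition weight :: "((nat \<Rightarrow> nat) \<Rightarrow> real) \<Rightarrow> (nat \<Rightarrow> nat) \<Rightarrow> nat \<Rightarrow> (nat \<Rightarrow> nat) \<Rightarrow> real" where
  "weight A z n w = (\<Prod>k<n. trans_prob A (w k) (orbit z w k))"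

text \<open>
  The Ruelle operator as a sum over symbols.  It agrees with \<^const>\<open>ruelle_operator\<close> on the
  shift space.
\<close>

definition transfer ::
    "nat \<Rightarrow> ((nat \<Rightarrow> nat) \<Rightarrow> real) \<Rightarrow> ((nat \<Rightarrow> nat) \<Rightarrow> real) \<Rightarrow> (nat \<Rightarrow> nat) \<Rightarrow> real" where
  "transfer d A f z = (\<Sum>i=1..d. trans_prob A i z * f (scons i z))"

lemma orbit_cong: "(\<And>k. k < n \<Longrightarrow> w k = v k) \<Longrightarrow> orbit z w n = orbit z v n"
  by (induction n) auto

lemma orbit_upd: "k \<le> n \<Longrightarrow> orbit z (w(n := i)) k = orbit z w k"
  by (rule orbit_cong) auto

lemma orbit_upd_Suc: "orbit z (w(n := i)) (Suc n) = scons i (orbit z w n)"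
  by (simp add: orbit_upd)

lemma weight_upd_Suc:
  "weight A z (Suc n) (w(n := i)) = weight A z n w * trans_prob A i (orbit z w n)"
  by (simp add: weight_def orbit_upd)

lemma weight_nonneg: "0 \<le> weight A z n w"
  by (simp add: weight_def trans_prob_def prod_nonneg)

text \<open>After \<open>n\<close> steps, the starting point is only visible beyond the first \<open>n\<close> coordinates.\<close>

lemma orbit_agree: "k < n \<Longrightarrow> orbit z w n k = orbit z' w n k"
  by (induction n arbitrary: k) (auto simp: scons_def split: nat.split)

lemma sum_addresses_Suc:
  assumes "1 \<le> d"
  shows "(\<Sum>w\<in>addresses d (Suc n). F w) = (\<Sum>w\<in>addresses d n. \<Sum>i=1..d. F (w(n := i)))"
proof -
  have "(\<Sum>w\<in>addresses d (Suc n). F w)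
      = (\<Sum>(w, i)\<in>addresses d n \<times> {1..d}. F (w(n := i)))"
  proof (rule sum.reindex_bij_witness[where i = "\<lambda>(w, i). w(n := i)" and j = "\<lambda>w. (w(n := 1), w n)"])
    fix p assume "p \<in> addresses d n \<times> {1..d}"
    then show "(case p of (w, i) \<Rightarrow> w(n := i)) \<in> addresses d (Suc n)"
      using assms by (auto simp: addresses_def bernoulli_space_def)
    show "((case p of (w, i) \<Rightarrow> w(n := i))(n := 1), (case p of (w, i) \<Rightarrow> w(n := i)) n) = p"
      using \<open>p \<in> _\<close> by (auto simp: addresses_def)
  next
    fix w assume "w \<in> addresses d (Suc n)"
    then show "(w(n := 1), w n) \<in> addresses d n \<times> {1..d}"
      using assms by (simp add: addresses_def bernoulli_space_def Suc_le_eq)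
  qed auto
  then show ?thesis
    by (simp add: sum.cartesian_product)
qed

lemma addresses_0: "1 \<le> d \<Longrightarrow> addresses d 0 = {\<lambda>_. 1}"
  by (auto simp: addresses_def bernoulli_space_def)

lemma finite_addresses: "finite (addresses d n)"
proof -
  have "addresses d n \<subseteq> (\<lambda>v k. if k < n then v k else 1) ` PiE {..<n} (\<lambda>_. {1..d})"
  proof
    fix w assume w: "w \<in> addresses d n"
    then have "w = (\<lambda>k. if k < n then restrict w {..<n} k else 1)"
      by (auto simp: addresses_def fun_eq_iff)
    moreover have "restrict w {..<n} \<in> PiE {..<n} (\<lambda>_. {1..d})"
      using w by (auto simp: addresses_def bernoulli_space_def)
    ultimately show "w \<in> (\<lambda>v k. if k < n then v k else 1) ` PiE {..<n} (\<lambda>_. {1..d})"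
      by blast
  qed
  then show ?thesis
    by (rule finite_subset) (intro finite_imageI finite_PiE; simp)
qed

lemma funpow_transfer:
  assumes "1 \<le> d"
  shows "(transfer d A ^^ n) f z = (\<Sum>w\<in>addresses d n. weight A z n w * f (orbit z w n))"
proof (induction n arbitrary: f)
  case 0
  then show ?case by (simp add: addresses_0[OF assms] weight_def)
next
  case (Suc n)
  have "(transfer d A ^^ Suc n) f z = (transfer d A ^^ n) (transfer d A f) z"
    by (simp add: funpow_swap1)
  also have "\<dots> = (\<Sum>w\<in>addresses d n. weight A z n w * transfer d A f (orbit z w n))"
    by (rule Suc.IH)
  also have "\<dots> = (\<Sum>w\<in>addresses d n. \<Sum>i=1..d.
      weight A z (Suc n) (w(n := i)) * f (orbit z (w(n := i)) (Suc n)))"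
    by (simp only: transfer_def sum_distrib_left orbit_upd_Suc weight_upd_Suc mult.assoc)
  also have "\<dots> = (\<Sum>w\<in>addresses d (Suc n). weight A z (Suc n) w * f (orbit z w (Suc n)))"
    by (simp only: sum_addresses_Suc[OF assms])
  finally show ?case .
qed


section \<open>Uniform convergence of the iterated transfer operator\<close>

locale ruelle_system = shift_space +
  fixes A :: "(nat \<Rightarrow> nat) \<Rightarrow> real"
  assumes Lipschitz: "Lipschitz_continuous_map (shift_metric \<theta> d) euclidean_metric A"
    and normalized: "normalized d A"
begin

abbreviation L :: "((nat \<Rightarrow> nat) \<Rightarrow> real) \<Rightarrow> (nat \<Rightarrow> nat) \<Rightarrow> real" where
  "L \<equiv> transfer d A"

abbreviation continuous\<^sub>\<Omega> :: "((nat \<Rightarrow> nat) \<Rightarrow> real) \<Rightarrow> bool" where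
  "continuous\<^sub>\<Omega> \<equiv> continuous_fun (shift_metric \<theta> d)"

lemma addresses_subset: "w \<in> addresses d n \<Longrightarrow> w \<in> \<Omega>"
  by (simp add: addresses_def)

lemma sum_trans_prob: "z \<in> \<Omega> \<Longrightarrow> (\<Sum>i=1..d. trans_prob A i z) = 1"
  using normalized by (simp add: normalized_def trans_prob_def)

lemma sum_weight:
  assumes "z \<in> \<Omega>"
  shows "(\<Sum>w\<in>addresses d n. weight A z n w) = 1"
proof (induction n)
  case 0
  then show ?case by (simp add: addresses_0[OF d_pos] weight_def)
next
  case (Suc n)
  have "(\<Sum>w\<in>addresses d (Suc n). weight A z (Suc n) w)
      = (\<Sum>w\<in>addresses d n. weight A z n w * (\<Sum>i=1..d. trans_prob A i (orbit z w n)))"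
    by (simp only: sum_addresses_Suc[OF d_pos] weight_upd_Suc sum_distrib_left)
  also have "\<dots> = (\<Sum>w\<in>addresses d n. weight A z n w)"
  proof (rule sum.cong)
    fix w assume "w \<in> addresses d n"
    then have "orbit z w n \<in> \<Omega>"
      using assms by (blast intro: addresses_subset)
    then show "weight A z n w * (\<Sum>i=1..d. trans_prob A i (orbit z w n)) = weight A z n w"
      by (simp only: sum_trans_prob mult_1_right)
  qed simp
  finally show ?case using Suc.IH by simp
qed

lemma continuous_transfer:
  assumes "continuous\<^sub>\<Omega> f"
  shows "continuous\<^sub>\<Omega> (L f)"
proof -
  have A: "continuous_map top\<^sub>\<Omega> euclideanreal A"
    using Lipschitz_continuous_imp_continuous_map[OF Lipschitz] by simp
  have "continuous_map top\<^sub>\<Omega> euclideanreal (\<lambda>z. trans_prob A i z * f (scons i z))"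
    if "i \<in> {1..d}" for i
  proof (rule continuous_map_real_mult)
    note scons = continuous_map_scons[OF that]
    have "continuous_map top\<^sub>\<Omega> euclideanreal (exp \<circ> (A \<circ> scons i))"
      by (intro continuous_map_compose[OF continuous_map_compose[OF scons A]])
         (simp add: continuous_on_exp)
    then show "continuous_map top\<^sub>\<Omega> euclideanreal (trans_prob A i)"
      by (simp add: trans_prob_def[abs_def] o_def)
    show "continuous_map top\<^sub>\<Omega> euclideanreal (\<lambda>z. f (scons i z))"
      using continuous_map_compose[OF scons] assms by (simp add: continuous_fun_def o_def)
  qed
  then show ?thesis
    unfolding continuous_fun_def transfer_def[abs_def] by (intro continuous_map_sum) auto
qed

lemma continuous_funpow_transfer: "continuous\<^sub>\<Omega> f \<Longrightarrow> continuous\<^sub>\<Omega> ((L ^^ n) f)"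
  by (induction n) (auto intro: continuous_transfer)

text \<open>
  Bounded distortion.  The orbits of \<open>z\<close> and \<open>z'\<close> along the same address approach each other
  geometrically, so the logarithms of the two weights differ by at most a geometric series.
\<close>

lemma weight_distortion:
  obtains \<delta> where "0 < \<delta>" "\<delta> \<le> 1"
    "\<And>n w z z'. \<lbrakk>w \<in> \<Omega>; z \<in> \<Omega>; z' \<in> \<Omega>\<rbrakk> \<Longrightarrow> \<delta> * weight A z' n w \<le> weight A z n w"
proof -
  obtain B where B: "B > 0" "\<And>x y. \<lbrakk>x \<in> \<Omega>; y \<in> \<Omega>\<rbrakk> \<Longrightarrow> \<bar>A x - A y\<bar> \<le> B * shift_dist \<theta> x y"
    using Lipschitz theta_pos theta_less_1 unfolding Lipschitz_continuous_map_pos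
    by (auto simp: mspace_shift_metric mdist_shift_metric dist_real_def)
  define C where "C = B / (1 - \<theta>)"
  have C: "C > 0" using B(1) theta_less_1 by (simp add: C_def)
  have weight: "weight A z n w = exp (\<Sum>k<n. A (orbit z w (Suc k)))" for z n w
    by (simp add: weight_def trans_prob_def exp_sum)
  have "exp (- C) * weight A z' n w \<le> weight A z n w"
    if w: "w \<in> \<Omega>" and z: "z \<in> \<Omega>" "z' \<in> \<Omega>" for n w z z'
  proof -
    have "(\<Sum>k<n. A (orbit z' w (Suc k))) - (\<Sum>k<n. A (orbit z w (Suc k)))
        = (\<Sum>k<n. A (orbit z' w (Suc k)) - A (orbit z w (Suc k)))"
      by (simp only: sum_subtractf)
    also have "\<dots> \<le> (\<Sum>k<n. B * \<theta> ^ k)"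
    proof (rule sum_mono)
      fix k
      have "A (orbit z' w (Suc k)) - A (orbit z w (Suc k))
          \<le> B * shift_dist \<theta> (orbit z' w (Suc k)) (orbit z w (Suc k))"
        using B(2)[OF orbit_in[OF w z(2)] orbit_in[OF w z(1)], of "Suc k" "Suc k"] by linarith
      also have "\<dots> \<le> B * \<theta> ^ Suc (Suc k)"
        using B(1) by (intro mult_left_mono shift_dist_le orbit_agree) auto
      also have "\<dots> \<le> B * \<theta> ^ k"
        using B(1) theta_pos theta_less_1 by (intro mult_left_mono power_decreasing) auto
      finally show "A (orbit z' w (Suc k)) - A (orbit z w (Suc k)) \<le> B * \<theta> ^ k" .
    qed
    also have "\<dots> = B * ((1 - \<theta> ^ n) / (1 - \<theta>))"
      using theta_less_1 by (simp add: sum_gp_strict flip: sum_distrib_left)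
    also have "\<dots> \<le> C"
      using B(1) theta_pos theta_less_1 by (simp add: C_def divide_right_mono)
    finally have "- C + (\<Sum>k<n. A (orbit z' w (Suc k))) \<le> (\<Sum>k<n. A (orbit z w (Suc k)))"
      by linarith
    then show ?thesis
      by (simp only: weight exp_le_cancel_iff flip: exp_add)
  qed
  then show ?thesis
    using C by (intro that[of "exp (- C)"]) auto
qed

text \<open>
  If \<open>f\<close> oscillates by at most \<open>r\<close> on the shift space and by at most \<open>s\<close> on cylinders of length
  \<open>n\<close>, then \<open>L\<^sup>n f\<close> oscillates by at most \<open>(1 - \<delta>) r + \<delta> s\<close>: a share \<open>\<delta>\<close> of the two address
  distributions is coupled, and coupled endpoints agree in the first \<open>n\<close> coordinates.
\<close>

lemma oscillation_contraction:
  assumes distortion: "\<And>w z z'. \<lbrakk>w \<in> \<Omega>; z \<in> \<Omega>; z' \<in> \<Omega>\<rbrakk> \<Longrightarrow> \<delta> * weight A z' n w \<le> weight A z n w"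
    and delta: "0 \<le> \<delta>"
    and osc: "\<And>x y. \<lbrakk>x \<in> \<Omega>; y \<in> \<Omega>\<rbrakk> \<Longrightarrow> f x - f y \<le> r"
    and var: "\<And>x y. \<lbrakk>x \<in> \<Omega>; y \<in> \<Omega>; \<And>k. k < n \<Longrightarrow> x k = y k\<rbrakk> \<Longrightarrow> f x - f y \<le> s"
    and z: "z \<in> \<Omega>" "z' \<in> \<Omega>"
  shows "(L ^^ n) f z' - (L ^^ n) f z \<le> (1 - \<delta>) * r + \<delta> * s"
proof -
  let ?W = "addresses d n" and ?p = "weight A z n" and ?p' = "weight A z' n"
  have orb: "orbit x w n \<in> \<Omega>" if "x \<in> \<Omega>" "w \<in> ?W" for x w
    using that by (blast intro: addresses_subset)
  \<comment> \<open>The mean of \<open>f\<close> over endpoints seen from \<open>z'\<close> exceeds no value of \<open>f\<close> by more than \<open>r\<close>.\<close>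
  have f_ge: "(L ^^ n) f z' - r \<le> f y" if "y \<in> \<Omega>" for y
  proof -
    have "(L ^^ n) f z' \<le> (\<Sum>v\<in>?W. ?p' v * (f y + r))"
      unfolding funpow_transfer[OF d_pos]
    proof (intro sum_mono mult_left_mono weight_nonneg)
      fix v assume "v \<in> ?W"
      then show "f (orbit z' v n) \<le> f y + r"
        using osc[OF orb[OF z(2)] that] by (simp add: diff_le_eq add.commute)
    qed
    also have "\<dots> = f y + r"
      by (simp add: sum_weight[OF z(2)] flip: sum_distrib_right)
    finally show ?thesis by simp
  qed
  \<comment> \<open>The uncoupled share has the nonnegative weights \<open>?p w - \<delta> * ?p' w\<close> of total mass \<open>1 - \<delta>\<close>.\<close>
  have "(1 - \<delta>) * ((L ^^ n) f z' - r) = (\<Sum>w\<in>?W. (?p w - \<delta> * ?p' w) * ((L ^^ n) f z' - r))"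
    by (simp add: sum_subtractf sum_weight z flip: sum_distrib_right sum_distrib_left)
  also have "\<dots> \<le> (\<Sum>w\<in>?W. (?p w - \<delta> * ?p' w) * f (orbit z w n))"
    using distortion[OF addresses_subset z] by (intro sum_mono mult_left_mono f_ge orb z) auto
  also have "\<dots> = (L ^^ n) f z - \<delta> * (\<Sum>w\<in>?W. ?p' w * f (orbit z w n))"
    by (simp add: funpow_transfer[OF d_pos] left_diff_distrib sum_subtractf sum_distrib_left mult.assoc)
  finally have 1: "(1 - \<delta>) * ((L ^^ n) f z' - r)
      \<le> (L ^^ n) f z - \<delta> * (\<Sum>w\<in>?W. ?p' w * f (orbit z w n))" .
  have "(L ^^ n) f z' - s = (\<Sum>w\<in>?W. ?p' w * (f (orbit z' w n) - s))"
    by (simp add: funpow_transfer[OF d_pos] right_diff_distrib sum_subtractf sum_weight z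
        flip: sum_distrib_right)
  also have "\<dots> \<le> (\<Sum>w\<in>?W. ?p' w * f (orbit z w n))"
  proof (intro sum_mono mult_left_mono weight_nonneg)
    fix w assume w: "w \<in> ?W"
    have "f (orbit z' w n) - f (orbit z w n) \<le> s"
      by (intro var orb z w orbit_agree)
    then show "f (orbit z' w n) - s \<le> f (orbit z w n)" by simp
  qed
  finally have "\<delta> * ((L ^^ n) f z' - s) \<le> \<delta> * (\<Sum>w\<in>?W. ?p' w * f (orbit z w n))"
    using delta by (rule mult_left_mono)
  with 1 show ?thesis
    by (simp add: algebra_simps)
qed

lemma oscillation_tendsto_0:
  assumes "continuous\<^sub>\<Omega> f" "\<epsilon> > 0"
  obtains n where "\<And>x y. \<lbrakk>x \<in> \<Omega>; y \<in> \<Omega>\<rbrakk> \<Longrightarrow> (L ^^ n) f x - (L ^^ n) f y \<le> \<epsilon>"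
proof -
  obtain \<delta> where delta: "0 < \<delta>" "\<delta> \<le> 1"
    and distortion: "\<And>n w z z'. \<lbrakk>w \<in> \<Omega>; z \<in> \<Omega>; z' \<in> \<Omega>\<rbrakk> \<Longrightarrow> \<delta> * weight A z' n w \<le> weight A z n w"
    by (rule weight_distortion) blast
  obtain K where K: "K > 0" "\<And>x. x \<in> \<Omega> \<Longrightarrow> \<bar>f x\<bar> \<le> K"
    using continuous_fun_bounded[OF assms(1)] by blast
  \<comment> \<open>The continuous function \<open>L\<^sup>n f\<close> varies by less than \<open>\<epsilon> / 2\<close> on cylinders of some length \<open>k\<close>,
    so applying \<open>L\<^sup>k\<close> contracts the part of its oscillation in excess of \<open>\<epsilon> / 2\<close> by \<open>1 - \<delta>\<close>.\<close>
  have step: "\<exists>n. \<forall>x\<in>\<Omega>. \<forall>y\<in>\<Omega>. (L ^^ n) f x - (L ^^ n) f y \<le> (1 - \<delta>) ^ m * (2 * K) + \<epsilon> / 2" for m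
  proof (induction m)
    case 0
    have "f x - f y \<le> 2 * K + \<epsilon> / 2" if "x \<in> \<Omega>" "y \<in> \<Omega>" for x y
      using K(2)[OF that(1)] K(2)[OF that(2)] assms(2) by linarith
    then show ?case by (intro exI[of _ 0]) simp
  next
    case (Suc m)
    let ?r = "(1 - \<delta>) ^ m * (2 * K) + \<epsilon> / 2"
    obtain n where n: "\<And>x y. \<lbrakk>x \<in> \<Omega>; y \<in> \<Omega>\<rbrakk> \<Longrightarrow> (L ^^ n) f x - (L ^^ n) f y \<le> ?r"
      using Suc.IH by blast
    obtain k where k: "\<And>x y. \<lbrakk>x \<in> \<Omega>; y \<in> \<Omega>; \<And>j. j < k \<Longrightarrow> x j = y j\<rbrakk>
        \<Longrightarrow> \<bar>(L ^^ n) f x - (L ^^ n) f y\<bar> < \<epsilon> / 2"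
      using continuous_fun_uniform[OF continuous_funpow_transfer[OF assms(1)], of "\<epsilon> / 2" n] assms(2)
      by auto
    have "(L ^^ (k + n)) f x - (L ^^ (k + n)) f y \<le> (1 - \<delta>) ^ Suc m * (2 * K) + \<epsilon> / 2"
      if xy: "x \<in> \<Omega>" "y \<in> \<Omega>" for x y
    proof -
      have "(L ^^ k) ((L ^^ n) f) x - (L ^^ k) ((L ^^ n) f) y \<le> (1 - \<delta>) * ?r + \<delta> * (\<epsilon> / 2)"
      proof (rule oscillation_contraction[OF distortion _ n _ xy(2) xy(1)])
        fix x y assume "x \<in> \<Omega>" "y \<in> \<Omega>" "\<And>j. j < k \<Longrightarrow> x j = y j"
        from k[OF this] show "(L ^^ n) f x - (L ^^ n) f y \<le> \<epsilon> / 2" by linarith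
      qed (use delta in auto)
      also have "\<dots> = (1 - \<delta>) ^ Suc m * (2 * K) + \<epsilon> / 2"
        by (simp add: field_simps)
      finally show ?thesis by (simp add: funpow_add)
    qed
    then show ?case by blast
  qed
  have "(\<lambda>m. (1 - \<delta>) ^ m * (2 * K)) \<longlonglongrightarrow> 0 * (2 * K)"
    using delta by (intro tendsto_mult tendsto_const LIMSEQ_realpow_zero) auto
  then have "\<forall>\<^sub>F m in sequentially. (1 - \<delta>) ^ m * (2 * K) < \<epsilon> / 2"
    using assms(2) by (intro order_tendstoD(2)[where y = "0 * (2 * K)"]) auto
  then obtain m where m: "(1 - \<delta>) ^ m * (2 * K) < \<epsilon> / 2"
    by (auto simp: eventually_sequentially)
  obtain n where n: "\<And>x y. \<lbrakk>x \<in> \<Omega>; y \<in> \<Omega>\<rbrakk>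
      \<Longrightarrow> (L ^^ n) f x - (L ^^ n) f y \<le> (1 - \<delta>) ^ m * (2 * K) + \<epsilon> / 2"
    using step[of m] by blast
  show ?thesis
  proof (rule that)
    fix x y assume "x \<in> \<Omega>" "y \<in> \<Omega>"
    from n[OF this] m show "(L ^^ n) f x - (L ^^ n) f y \<le> \<epsilon>" by linarith
  qed
qed

lemma ruelle_operator_eq_transfer:
  assumes "z \<in> \<Omega>"
  shows "ruelle_operator d A f z = L f z"
  unfolding ruelle_operator_def transfer_def trans_prob_def
proof (rule sum.reindex_bij_witness[where i = "\<lambda>i. scons i z" and j = "\<lambda>w. w 0"])
  fix w assume w: "w \<in> {w. w \<in> \<Omega> \<and> shift w = z}"
  show eq: "scons (w 0) z = w"
    using w by (auto simp: scons_def shift_def fun_eq_iff split: nat.split)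
  show "w 0 \<in> {1..d}" using w by (simp add: bernoulli_space_def)
  show "exp (A (scons (w 0) z)) * f (scons (w 0) z) = exp (A w) * f w" by (simp only: eq)
next
  fix i assume "i \<in> {1..d}"
  then show "scons i z \<in> {w. w \<in> \<Omega> \<and> shift w = z}"
    using scons_in assms by (simp add: shift_def scons_def)
qed (simp add: scons_def)

lemma integral_funpow_transfer:
  assumes "gibbs_measure \<theta> d A \<mu>" "continuous\<^sub>\<Omega> f"
  shows "(\<integral>x. (L ^^ n) f x \<partial>\<mu>) = (\<integral>x. f x \<partial>\<mu>)"
proof (induction n)
  case (Suc n)
  have mu: "borel_prob (shift_metric \<theta> d) \<mu>"
    and dual: "\<And>\<psi>. continuous\<^sub>\<Omega> \<psi> \<Longrightarrow> (\<integral>x. \<psi> x \<partial>\<mu>) = (\<integral>x. ruelle_operator d A \<psi> x \<partial>\<mu>)"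
    using assms(1) by (auto simp: gibbs_measure_def is_dual_image_def)
  have "(\<integral>x. (L ^^ Suc n) f x \<partial>\<mu>) = (\<integral>x. ruelle_operator d A ((L ^^ n) f) x \<partial>\<mu>)"
    by (intro Bochner_Integration.integral_cong)
       (simp_all add: borel_prob_space[OF mu] ruelle_operator_eq_transfer)
  also have "\<dots> = (\<integral>x. (L ^^ n) f x \<partial>\<mu>)"
    by (rule dual[symmetric]) (rule continuous_funpow_transfer[OF assms(2)])
  finally show ?case using Suc.IH by simp
qed simp

lemma funpow_transfer_uniform:
  assumes "gibbs_measure \<theta> d A \<mu>" "continuous\<^sub>\<Omega> f" "\<epsilon> > 0"
  obtains n where "\<And>z. z \<in> \<Omega> \<Longrightarrow> \<bar>(L ^^ n) f z - (\<integral>x. f x \<partial>\<mu>)\<bar> \<le> \<epsilon>"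
proof -
  have mu: "borel_prob (shift_metric \<theta> d) \<mu>"
    using assms(1) by (simp add: gibbs_measure_def is_dual_image_def)
  then interpret prob_space \<mu> by (simp add: borel_prob_def)
  obtain n where n: "\<And>x y. \<lbrakk>x \<in> \<Omega>; y \<in> \<Omega>\<rbrakk> \<Longrightarrow> (L ^^ n) f x - (L ^^ n) f y \<le> \<epsilon>"
    using oscillation_tendsto_0[OF assms(2,3)] by blast
  let ?g = "(L ^^ n) f"
  have g: "continuous\<^sub>\<Omega> ?g" by (rule continuous_funpow_transfer[OF assms(2)])
  obtain K where K: "\<And>x. x \<in> \<Omega> \<Longrightarrow> \<bar>?g x\<bar> \<le> K"
    using continuous_fun_bounded[OF g] by blast
  have int: "integrable \<mu> ?g"
    using K by (intro integrable_const_bound[of _ K] continuous_fun_measurable[OF mu g] AE_I2)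
      (simp add: borel_prob_space[OF mu])
  show ?thesis
  proof (rule that)
    fix z assume z: "z \<in> \<Omega>"
    have "expectation ?g \<le> expectation (\<lambda>_. ?g z + \<epsilon>)"
      using n[OF _ z] by (intro integral_mono int) (auto simp: borel_prob_space[OF mu] diff_le_eq add.commute)
    moreover have "expectation (\<lambda>_. ?g z - \<epsilon>) \<le> expectation ?g"
      using n[OF z] by (intro integral_mono int) (auto simp: borel_prob_space[OF mu] algebra_simps)
    ultimately have "\<bar>?g z - expectation ?g\<bar> \<le> \<epsilon>"
      by (simp add: prob_space abs_le_iff)
    then show "\<bar>?g z - (\<integral>x. f x \<partial>\<mu>)\<bar> \<le> \<epsilon>"
      by (simp only: integral_funpow_transfer[OF assms(1,2)])
  qed
qed

section \<open>Law of large numbers for the martingale differences\<close>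

text \<open>
  The sum of the first \<open>n\<close> differences between \<open>h\<close> at the next point of the orbit and the
  conditional mean of that value.
\<close>

definition martingale ::
    "((nat \<Rightarrow> nat) \<Rightarrow> real) \<Rightarrow> (nat \<Rightarrow> nat) \<Rightarrow> nat \<Rightarrow> (nat \<Rightarrow> nat) \<Rightarrow> real" where
  "martingale h z n w = (\<Sum>k<n. h (orbit z w (Suc k)) - L h (orbit z w k))"

lemma martingale_cong:
  assumes "\<And>k. k < n \<Longrightarrow> w k = v k"
  shows "martingale h z n w = martingale h z n v"
  unfolding martingale_def
proof (rule sum.cong)
  fix k assume k: "k \<in> {..<n}"
  have "orbit z w k = orbit z v k" "orbit z w (Suc k) = orbit z v (Suc k)"
    using k assms by (intro orbit_cong; simp)+
  then show "h (orbit z w (Suc k)) - L h (orbit z w k) = h (orbit z v (Suc k)) - L h (orbit z v k)"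
    by (simp only:)
qed simp

lemma martingale_upd_Suc:
  "martingale h z (Suc n) (w(n := i))
    = martingale h z n w + (h (scons i (orbit z w n)) - L h (orbit z w n))"
proof -
  have "martingale h z n (w(n := i)) = martingale h z n w"
    by (rule martingale_cong) simp
  then show ?thesis
    by (simp add: martingale_def orbit_upd)
qed

lemma transfer_uminus: "L (\<lambda>x. - h x) z = - L h z"
  by (simp add: transfer_def sum_negf)

lemma martingale_uminus: "martingale (\<lambda>x. - h x) z n w = - martingale h z n w"
  by (simp add: martingale_def transfer_uminus flip: sum_negf)

lemma abs_transfer_le:
  assumes "\<And>x. x \<in> \<Omega> \<Longrightarrow> \<bar>h x\<bar> \<le> K" "z \<in> \<Omega>"
  shows "\<bar>L h z\<bar> \<le> K"
proof -
  have "\<bar>L h z\<bar> \<le> (\<Sum>i=1..d. \<bar>trans_prob A i z * h (scons i z)\<bar>)"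
    unfolding transfer_def by (rule sum_abs)
  also have "\<dots> \<le> (\<Sum>i=1..d. trans_prob A i z * K)"
  proof (rule sum_mono)
    fix i assume "i \<in> {1..d}"
    then have "\<bar>h (scons i z)\<bar> \<le> K" using assms scons_in by blast
    then show "\<bar>trans_prob A i z * h (scons i z)\<bar> \<le> trans_prob A i z * K"
      by (simp add: abs_mult trans_prob_def)
  qed
  also have "\<dots> = K"
    using sum_trans_prob[OF assms(2)] by (simp flip: sum_distrib_right)
  finally show ?thesis .
qed

lemma exp_le_quadratic:
  fixes x :: real
  assumes "x \<le> 1"
  shows "exp x \<le> 1 + x + x\<^sup>2"
proof (cases "0 \<le> x")
  case True
  then show ?thesis using exp_bound assms by blast
next
  case False
  define y where "y = - x"
  have y: "y \<ge> 0" using False by (simp add: y_def)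
  \<comment> \<open>Multiplied by \<open>exp y\<close>, the claim becomes a polynomial inequality via \<open>exp y \<ge> 1 + y + y\<^sup>2 / 2\<close>.\<close>
  have "1 \<le> (1 - y + y\<^sup>2) * (1 + y + y\<^sup>2 / 2)"
  proof -
    have "(1 - y + y\<^sup>2) * (1 + y + y\<^sup>2 / 2) = 1 + (y ^ 2 + y ^ 3 + y ^ 4) / 2"
      by (simp add: field_simps eval_nat_numeral)
    then show ?thesis using y by simp
  qed
  also have "\<dots> \<le> (1 - y + y\<^sup>2) * exp y"
  proof (rule mult_left_mono)
    show "1 + y + y\<^sup>2 / 2 \<le> exp y"
      using exp_lower_Taylor_quadratic[OF y] by simp
    have "1 - y + y\<^sup>2 = (1 - y / 2)\<^sup>2 + 3 / 4 * y\<^sup>2"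
      by (simp add: field_simps power2_eq_square)
    then show "0 \<le> 1 - y + y\<^sup>2" by simp
  qed
  finally have "exp (- y) \<le> 1 - y + y\<^sup>2"
    by (simp add: exp_minus field_simps)
  then show ?thesis by (simp add: y_def)
qed

text \<open>
  The conditional exponential moment of one martingale difference, which is at most \<open>2 K\<close> in
  absolute value.  The linear term of the expansion vanishes because the difference is centred.
\<close>

lemma exponential_moment_step:
  assumes "\<And>x. x \<in> \<Omega> \<Longrightarrow> \<bar>h x\<bar> \<le> K" "z \<in> \<Omega>" "0 \<le> t" "t * (2 * K) \<le> 1"
  shows "(\<Sum>i=1..d. trans_prob A i z * exp (t * (h (scons i z) - L h z))) \<le> exp ((t * (2 * K))\<^sup>2)"
proof -
  let ?D = "\<lambda>i. h (scons i z) - L h z"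
  have D: "\<bar>t * ?D i\<bar> \<le> t * (2 * K)" if "i \<in> {1..d}" for i
  proof -
    have "\<bar>?D i\<bar> \<le> 2 * K"
      using assms(1)[OF scons_in[OF that assms(2)]] abs_transfer_le[of h K z, OF assms(1,2)] by linarith
    then show ?thesis using assms(3) by (simp add: abs_mult mult_left_mono)
  qed
  have "(\<Sum>i=1..d. trans_prob A i z * exp (t * ?D i))
      \<le> (\<Sum>i=1..d. trans_prob A i z * (1 + t * ?D i + (t * (2 * K))\<^sup>2))"
  proof (intro sum_mono mult_left_mono)
    fix i assume i: "i \<in> {1..d}"
    have "exp (t * ?D i) \<le> 1 + t * ?D i + (t * ?D i)\<^sup>2"
      using D[OF i] assms(4) by (intro exp_le_quadratic) linarith
    also have "(t * ?D i)\<^sup>2 \<le> (t * (2 * K))\<^sup>2"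
      using D[OF i] by (rule abs_le_square_iff[THEN iffD1, OF order_trans]) simp
    finally show "exp (t * ?D i) \<le> 1 + t * ?D i + (t * (2 * K))\<^sup>2" by simp
  qed (simp add: trans_prob_def)
  also have "\<dots> = 1 + (t * (2 * K))\<^sup>2"
  proof -
    have "(\<Sum>i=1..d. trans_prob A i z * (1 + t * (h (scons i z) - l) + c))
        = (1 + c - t * l) * (\<Sum>i=1..d. trans_prob A i z) + t * L h z" for l c
      by (simp add: transfer_def algebra_simps sum.distrib sum_subtractf sum_distrib_left)
    then show ?thesis
      by (simp only: sum_trans_prob[OF assms(2)]) simp
  qed
  also have "\<dots> \<le> exp ((t * (2 * K))\<^sup>2)"
    by (rule exp_ge_add_one_self)
  finally show ?thesis .
qed

lemma exponential_moment:
  assumes "\<And>x. x \<in> \<Omega> \<Longrightarrow> \<bar>h x\<bar> \<le> K" "z \<in> \<Omega>" "0 \<le> t" "t * (2 * K) \<le> 1"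
  shows "(\<Sum>w\<in>addresses d n. weight A z n w * exp (t * martingale h z n w))
    \<le> exp (real n * (t * (2 * K))\<^sup>2)"
proof (induction n)
  case 0
  then show ?case by (simp add: addresses_0[OF d_pos] weight_def martingale_def)
next
  case (Suc n)
  let ?E = "\<lambda>n w. weight A z n w * exp (t * martingale h z n w)"
  have "(\<Sum>w\<in>addresses d (Suc n). ?E (Suc n) w)
      = (\<Sum>w\<in>addresses d n. ?E n w * (\<Sum>i=1..d. trans_prob A i (orbit z w n)
          * exp (t * (h (scons i (orbit z w n)) - L h (orbit z w n)))))"
    unfolding sum_addresses_Suc[OF d_pos] weight_upd_Suc martingale_upd_Suc sum_distrib_left
      distrib_left[of t] exp_add
    by (simp only: mult_ac)
  also have "\<dots> \<le> (\<Sum>w\<in>addresses d n. ?E n w * exp ((t * (2 * K))\<^sup>2))"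
  proof (intro sum_mono mult_left_mono)
    fix w assume "w \<in> addresses d n"
    then have "orbit z w n \<in> \<Omega>"
      using assms(2) by (blast intro: addresses_subset)
    then show "(\<Sum>i=1..d. trans_prob A i (orbit z w n)
        * exp (t * (h (scons i (orbit z w n)) - L h (orbit z w n)))) \<le> exp ((t * (2 * K))\<^sup>2)"
      using assms(1,3,4) by (intro exponential_moment_step) auto
  qed (simp add: weight_nonneg)
  also have "\<dots> \<le> exp (real n * (t * (2 * K))\<^sup>2) * exp ((t * (2 * K))\<^sup>2)"
    unfolding sum_distrib_right[symmetric] by (intro mult_right_mono Suc.IH) simp
  also have "\<dots> = exp (real (Suc n) * (t * (2 * K))\<^sup>2)"
    by (simp add: algebra_simps flip: exp_add)
  finally show ?case .
qed

lemma measure_cylinder: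
  assumes "address_law \<theta> d A z P" "w \<in> \<Omega>"
  shows "measure P (cylinder n w) = weight A z n w"
  using assms by (simp add: address_law_def cylinder_def weight_def)

lemma deviation_event_eq:
  "{\<omega> \<in> \<Omega>. a \<le> martingale h z n \<omega>}
    = (\<Union>w\<in>{w \<in> addresses d n. a \<le> martingale h z n w}. cylinder n w)"
proof (intro equalityI subsetI)
  fix \<omega> assume \<omega>: "\<omega> \<in> {\<omega> \<in> \<Omega>. a \<le> martingale h z n \<omega>}"
  let ?w = "\<lambda>k. if k < n then \<omega> k else 1"
  have "martingale h z n ?w = martingale h z n \<omega>"
    by (rule martingale_cong) simp
  then show "\<omega> \<in> (\<Union>w\<in>{w \<in> addresses d n. a \<le> martingale h z n w}. cylinder n w)"
    using \<omega> d_pos by (intro UN_I[of ?w]) (auto simp: addresses_def bernoulli_space_def cylinder_def)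
next
  fix \<omega> assume "\<omega> \<in> (\<Union>w\<in>{w \<in> addresses d n. a \<le> martingale h z n w}. cylinder n w)"
  then obtain w where w: "a \<le> martingale h z n w" "\<omega> \<in> cylinder n w" by blast
  have "martingale h z n \<omega> = martingale h z n w"
    using w(2) by (intro martingale_cong) (simp add: cylinder_def)
  then show "\<omega> \<in> {\<omega> \<in> \<Omega>. a \<le> martingale h z n \<omega>}"
    using w by (simp add: cylinder_def)
qed

lemma deviation_event_measurable:
  assumes "address_law \<theta> d A z P"
  shows "{\<omega> \<in> \<Omega>. a \<le> martingale h z n \<omega>} \<in> sets P"
  unfolding deviation_event_eq using assms finite_addresses
  by (intro sets.finite_UN borel_prob_openin openin_cylinder) (auto simp: address_law_def)

text \<open>
  The Chernoff bound.  The event is a finite union of cylinders, so only the cylinder probabilities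
  of the address law are needed.
\<close>

lemma deviation_probability:
  assumes law: "address_law \<theta> d A z P"
    and h: "\<And>x. x \<in> \<Omega> \<Longrightarrow> \<bar>h x\<bar> \<le> K" and z: "z \<in> \<Omega>" and t: "0 \<le> t" "t * (2 * K) \<le> 1"
  shows "measure P {\<omega> \<in> \<Omega>. a \<le> martingale h z n \<omega>} \<le> exp (real n * (t * (2 * K))\<^sup>2 - t * a)"
proof -
  let ?W = "{w \<in> addresses d n. a \<le> martingale h z n w}"
  have P: "borel_prob (shift_metric \<theta> d) P"
    using law by (simp add: address_law_def)
  have W: "finite ?W" using finite_addresses[of d n] by simp
  have "measure P (\<Union>w\<in>?W. cylinder n w) \<le> (\<Sum>w\<in>?W. measure P (cylinder n w))"
    by (rule measure_UNION_le[OF W borel_prob_openin[OF P openin_cylinder]])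
  also have "\<dots> = (\<Sum>w\<in>?W. weight A z n w)"
    by (intro sum.cong refl measure_cylinder[OF law]) (simp add: addresses_def)
  also have "\<dots> \<le> (\<Sum>w\<in>?W. weight A z n w * exp (t * martingale h z n w - t * a))"
  proof (rule sum_mono)
    fix w assume "w \<in> ?W"
    then have "1 \<le> exp (t * martingale h z n w - t * a)"
      using t(1) by (simp add: mult_left_mono)
    from mult_left_mono[OF this weight_nonneg[of A z n w]]
    show "weight A z n w \<le> weight A z n w * exp (t * martingale h z n w - t * a)"
      by (simp only: mult_1_right)
  qed
  also have "\<dots> \<le> (\<Sum>w\<in>addresses d n. weight A z n w * exp (t * martingale h z n w - t * a))"
    by (intro sum_mono2 finite_addresses) (auto simp: weight_nonneg)
  also have "\<dots> = (\<Sum>w\<in>addresses d n. weight A z n w * exp (t * martingale h z n w)) * exp (- (t * a))"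
    by (simp add: sum_distrib_right exp_diff exp_minus divide_inverse mult.assoc)
  also have "\<dots> \<le> exp (real n * (t * (2 * K))\<^sup>2) * exp (- (t * a))"
    by (intro mult_right_mono exponential_moment h z t) simp_all
  also have "\<dots> = exp (real n * (t * (2 * K))\<^sup>2 - t * a)"
    by (simp add: exp_diff exp_minus divide_inverse)
  finally show ?thesis unfolding deviation_event_eq .
qed

lemma eventually_martingale_less:
  assumes law: "address_law \<theta> d A z P" and z: "z \<in> \<Omega>"
    and K: "\<And>x. x \<in> \<Omega> \<Longrightarrow> \<bar>h x\<bar> \<le> K" "K > 0" and e: "\<epsilon> > 0"
  shows "AE \<omega> in P. \<forall>\<^sub>F n in sequentially. martingale h z n \<omega> < \<epsilon> * real n"
proof -
  have P: "borel_prob (shift_metric \<theta> d) P"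
    using law by (simp add: address_law_def)
  then interpret prob_space P by (simp add: borel_prob_def)
  let ?B = "\<lambda>n. {\<omega> \<in> \<Omega>. \<epsilon> * real n \<le> martingale h z n \<omega>}"
  \<comment> \<open>With this exponent the bound decays at least like \<open>exp (- t \<epsilon> n / 2)\<close>.\<close>
  define t where "t = min (1 / (2 * K)) (\<epsilon> / (2 * (2 * K)\<^sup>2))"
  have t: "t > 0" using K(2) e by (simp add: t_def)
  have tK: "t * (2 * K) \<le> 1"
    using K(2) by (simp add: t_def min_def field_simps split: if_splits)
  have "t \<le> \<epsilon> / (2 * (2 * K)\<^sup>2)" by (simp add: t_def)
  then have te: "t * (2 * K)\<^sup>2 \<le> \<epsilon> / 2"
    using K(2) by (simp add: field_simps)
  have bound: "prob (?B n) \<le> exp (- (t * \<epsilon> / 2)) ^ n" for n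
  proof -
    have "prob (?B n) \<le> exp (real n * (t * (2 * K))\<^sup>2 - t * (\<epsilon> * real n))"
      using t by (intro deviation_probability[OF law K(1) z _ tK]) auto
    also have "real n * (t * (2 * K))\<^sup>2 - t * (\<epsilon> * real n) = real n * (t * (t * (2 * K)\<^sup>2 - \<epsilon>))"
      by (simp add: power2_eq_square algebra_simps)
    also have "exp \<dots> \<le> exp (real n * (t * (- (\<epsilon> / 2))))"
    proof -
      have "t * (2 * K)\<^sup>2 - \<epsilon> \<le> - (\<epsilon> / 2)" using te by linarith
      then show ?thesis using t by (simp only: exp_le_cancel_iff mult_left_mono of_nat_0_le_iff less_imp_le)
    qed
    also have "\<dots> = exp (- (t * \<epsilon> / 2)) ^ n"
      by (simp flip: exp_of_nat_mult)
    finally show ?thesis .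
  qed
  have "summable (\<lambda>n. prob (?B n))"
  proof (rule summable_comparison_test')
    show "summable (\<lambda>n. exp (- (t * \<epsilon> / 2)) ^ n)"
      using t e by (intro summable_geometric) simp
    show "norm (prob (?B n)) \<le> exp (- (t * \<epsilon> / 2)) ^ n" if "0 \<le> n" for n
      using bound[of n] by simp
  qed
  then have "AE \<omega> in P. \<forall>\<^sub>F n in sequentially. \<omega> \<in> space P - ?B n"
    by (intro borel_cantelli_AE1 deviation_event_measurable[OF law]) (simp_all add: less_top[symmetric])
  then show ?thesis
  proof (rule AE_mp, intro AE_I2 impI)
    fix \<omega> assume "\<forall>\<^sub>F n in sequentially. \<omega> \<in> space P - ?B n"
    then show "\<forall>\<^sub>F n in sequentially. martingale h z n \<omega> < \<epsilon> * real n"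
      by (rule eventually_mono) (simp add: borel_prob_space[OF P] not_le)
  qed
qed

lemma martingale_averages:
  assumes law: "address_law \<theta> d A z P" and z: "z \<in> \<Omega>" and h: "continuous\<^sub>\<Omega> h"
  shows "AE \<omega> in P. (\<lambda>n. 1 / real n * martingale h z n \<omega>) \<longlonglongrightarrow> 0"
proof -
  obtain K where K: "K > 0" "\<And>x. x \<in> \<Omega> \<Longrightarrow> \<bar>h x\<bar> \<le> K"
    using continuous_fun_bounded[OF h] by blast
  have K': "\<bar>- h x\<bar> \<le> K" if "x \<in> \<Omega>" for x using K(2)[OF that] by simp
  have "AE \<omega> in P. (\<forall>\<^sub>F n in sequentially. martingale h z n \<omega> < 1 / real (Suc m) * real n)
      \<and> (\<forall>\<^sub>F n in sequentially. - martingale h z n \<omega> < 1 / real (Suc m) * real n)" for m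
    using eventually_martingale_less[OF law z K(2) K(1), where \<epsilon> = "1 / real (Suc m)"]
      eventually_martingale_less[OF law z K' K(1), where \<epsilon> = "1 / real (Suc m)"]
    unfolding martingale_uminus by simp
  then have "AE \<omega> in P. \<forall>m. (\<forall>\<^sub>F n in sequentially. martingale h z n \<omega> < 1 / real (Suc m) * real n)
      \<and> (\<forall>\<^sub>F n in sequentially. - martingale h z n \<omega> < 1 / real (Suc m) * real n)"
    by (simp only: AE_all_countable) blast
  then show ?thesis
  proof (rule AE_mp, intro AE_I2 impI)
    fix \<omega>
    assume *: "\<forall>m. (\<forall>\<^sub>F n in sequentially. martingale h z n \<omega> < 1 / real (Suc m) * real n)
      \<and> (\<forall>\<^sub>F n in sequentially. - martingale h z n \<omega> < 1 / real (Suc m) * real n)"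
    show "(\<lambda>n. 1 / real n * martingale h z n \<omega>) \<longlonglongrightarrow> 0"
    proof (rule tendstoI)
      fix r :: real assume "r > 0"
      then obtain m where m: "1 / real (Suc m) < r"
        using nat_approx_posE by blast
      have "\<forall>\<^sub>F n in sequentially. martingale h z n \<omega> < 1 / real (Suc m) * real n
          \<and> - martingale h z n \<omega> < 1 / real (Suc m) * real n \<and> 0 < n"
        using * eventually_gt_at_top[of 0] by (simp add: eventually_conj_iff)
      then show "\<forall>\<^sub>F n in sequentially. dist (1 / real n * martingale h z n \<omega>) 0 < r"
      proof (rule eventually_mono, elim conjE)
        fix n :: nat
        assume "martingale h z n \<omega> < 1 / real (Suc m) * real n"
          "- martingale h z n \<omega> < 1 / real (Suc m) * real n" and n: "0 < n"
        then have "\<bar>martingale h z n \<omega>\<bar> < 1 / real (Suc m) * real n" by linarith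
        also have "\<dots> < r * real n" using m n by (intro mult_strict_right_mono) auto
        finally show "dist (1 / real n * martingale h z n \<omega>) 0 < r"
          using n by (simp add: abs_mult divide_less_eq)
      qed
    qed
  qed
qed

section \<open>Averages along the orbit\<close>

lemma averages_transfer:
  assumes law: "address_law \<theta> d A z P" and z: "z \<in> \<Omega>" and h: "continuous\<^sub>\<Omega> h"
  shows "AE \<omega> in P. (\<lambda>n. 1 / real n * (\<Sum>k<n. h (orbit z \<omega> k) - L h (orbit z \<omega> k))) \<longlonglongrightarrow> 0"
  using martingale_averages[OF assms]
proof (rule AE_mp, intro AE_I2 impI)
  fix \<omega> assume \<omega>: "\<omega> \<in> space P" and lim: "(\<lambda>n. 1 / real n * martingale h z n \<omega>) \<longlonglongrightarrow> 0"
  have \<omega>: "\<omega> \<in> \<Omega>"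
    using \<omega> law by (simp add: borel_prob_space address_law_def)
  obtain K where K: "\<And>x. x \<in> \<Omega> \<Longrightarrow> \<bar>h x\<bar> \<le> K"
    using continuous_fun_bounded[OF h] by blast
  have "(\<lambda>n. 1 / real n * (h z - h (orbit z \<omega> n))) \<longlonglongrightarrow> 0"
  proof (rule Lim_null_comparison)
    show "(\<lambda>n. 2 * K * (1 / real n)) \<longlonglongrightarrow> 0"
      by (rule tendsto_mult_right_zero) (rule lim_1_over_n)
    have "\<bar>h z - h (orbit z \<omega> n)\<bar> \<le> 2 * K" for n
      using K[OF z] K[OF orbit_in[OF \<omega> z, of n]] by linarith
    then show "\<forall>\<^sub>F n in sequentially. norm (1 / real n * (h z - h (orbit z \<omega> n))) \<le> 2 * K * (1 / real n)"
      by (intro always_eventually) (simp add: abs_mult divide_right_mono)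
  qed
  \<comment> \<open>The sum differs from the martingale by a bounded telescoping term.\<close>
  moreover have "(\<Sum>k<n. h (orbit z \<omega> k) - L h (orbit z \<omega> k))
      = (h z - h (orbit z \<omega> n)) + martingale h z n \<omega>" for n
    by (induction n) (simp_all add: martingale_def)
  ultimately show "(\<lambda>n. 1 / real n * (\<Sum>k<n. h (orbit z \<omega> k) - L h (orbit z \<omega> k))) \<longlonglongrightarrow> 0"
    using tendsto_add[OF _ lim] by (simp add: distrib_left)
qed

lemma averages_funpow_transfer:
  assumes law: "address_law \<theta> d A z P" and z: "z \<in> \<Omega>" and h: "continuous\<^sub>\<Omega> h"
  shows "AE \<omega> in P. (\<lambda>N. 1 / real N * (\<Sum>k<N. h (orbit z \<omega> k) - (L ^^ n) h (orbit z \<omega> k))) \<longlonglongrightarrow> 0"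
proof (induction n)
  case (Suc n)
  from Suc.IH averages_transfer[OF law z continuous_funpow_transfer[OF h, of n]]
  show ?case
  proof eventually_elim
    case (elim \<omega>)
    have "1 / real N * (\<Sum>k<N. h (orbit z \<omega> k) - (L ^^ n) h (orbit z \<omega> k))
        + 1 / real N * (\<Sum>k<N. (L ^^ n) h (orbit z \<omega> k) - L ((L ^^ n) h) (orbit z \<omega> k))
        = 1 / real N * (\<Sum>k<N. h (orbit z \<omega> k) - (L ^^ Suc n) h (orbit z \<omega> k))" for N
      unfolding distrib_left[symmetric] sum.distrib[symmetric] by simp
    with tendsto_add[OF elim] show ?case
      by (simp only: add_0_left)
  qed
qed simp

theorem averages_tendsto_integral:
  assumes gibbs: "gibbs_measure \<theta> d A \<mu>" and law: "address_law \<theta> d A z P"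
    and z: "z \<in> \<Omega>" and f: "continuous\<^sub>\<Omega> f"
  shows "AE \<omega> in P. (\<lambda>N. 1 / real N * (\<Sum>k<N. f (orbit z \<omega> k))) \<longlonglongrightarrow> (\<integral>x. f x \<partial>\<mu>)"
proof -
  let ?c = "\<integral>x. f x \<partial>\<mu>"
  have "AE \<omega> in P. \<forall>n. (\<lambda>N. 1 / real N * (\<Sum>k<N. f (orbit z \<omega> k) - (L ^^ n) f (orbit z \<omega> k))) \<longlonglongrightarrow> 0"
    using averages_funpow_transfer[OF law z f] by (simp only: AE_all_countable) blast
  then show ?thesis
  proof (rule AE_mp, intro AE_I2 impI)
    fix \<omega> assume "\<omega> \<in> space P"
      and lim: "\<forall>n. (\<lambda>N. 1 / real N * (\<Sum>k<N. f (orbit z \<omega> k) - (L ^^ n) f (orbit z \<omega> k))) \<longlonglongrightarrow> 0"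
    then have \<omega>: "\<omega> \<in> \<Omega>"
      using law by (simp add: borel_prob_space address_law_def)
    show "(\<lambda>N. 1 / real N * (\<Sum>k<N. f (orbit z \<omega> k))) \<longlonglongrightarrow> ?c"
    proof (rule tendstoI)
      fix r :: real assume r: "r > 0"
      then have "0 < r / 2" by simp
      then obtain n where n: "\<And>x. x \<in> \<Omega> \<Longrightarrow> \<bar>(L ^^ n) f x - ?c\<bar> \<le> r / 2"
        using funpow_transfer_uniform[OF gibbs f] by blast
      let ?S = "\<lambda>N. \<Sum>k<N. f (orbit z \<omega> k) - (L ^^ n) f (orbit z \<omega> k)"
      have "\<forall>\<^sub>F N in sequentially. dist (1 / real N * ?S N) 0 < r / 2"
        using lim r by (intro tendstoD) auto
      then show "\<forall>\<^sub>F N in sequentially. dist (1 / real N * (\<Sum>k<N. f (orbit z \<omega> k))) ?c < r"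
        using eventually_gt_at_top[of 0]
      proof eventually_elim
        case (elim N)
        have "1 / real N * (\<Sum>k<N. f (orbit z \<omega> k)) - ?c
            = 1 / real N * ?S N + 1 / real N * (\<Sum>k<N. (L ^^ n) f (orbit z \<omega> k) - ?c)"
          using elim(2) by (simp add: sum_subtractf field_simps)
        moreover have "\<bar>1 / real N * (\<Sum>k<N. (L ^^ n) f (orbit z \<omega> k) - ?c)\<bar> \<le> r / 2"
        proof -
          have "\<bar>\<Sum>k<N. (L ^^ n) f (orbit z \<omega> k) - ?c\<bar> \<le> (\<Sum>k<N. \<bar>(L ^^ n) f (orbit z \<omega> k) - ?c\<bar>)"
            by (rule sum_abs)
          also have "\<dots> \<le> (\<Sum>k<N. r / 2)"
            by (intro sum_mono n orbit_in \<omega> z)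
          finally show ?thesis
            using elim(2) by (simp add: abs_mult field_simps)
        qed
        ultimately show ?case
          using elim(1) unfolding dist_real_def by linarith
      qed
    qed
  qed
qed

end

theorem theorem2:
  fixes \<theta> :: real and d :: nat
    and A f :: "(nat \<Rightarrow> nat) \<Rightarrow> real"
    and \<mu> P :: "(nat \<Rightarrow> nat) measure"
    and z\<^sub>0 :: "nat \<Rightarrow> nat"
  assumes "0 < \<theta>" "\<theta> < 1" and "d \<ge> 2"
    and "Lipschitz_continuous_map (shift_metric \<theta> d) euclidean_metric A"
    and "normalized d A"
    and "gibbs_measure \<theta> d A \<mu>"
    and "z\<^sub>0 \<in> bernoulli_space d"
    and "address_law \<theta> d A z\<^sub>0 P"
    and "continuous_fun (shift_metric \<theta> d) f"
  shows "AE \<omega> in P. (\<lambda>N. (1 / real N) * (\<Sum>k<N. f (orbit z\<^sub>0 \<omega> k)))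
           \<longlonglongrightarrow> (\<integral>x. f x \<partial>\<mu>)"
proof -
  interpret ruelle_system \<theta> d A
    using assms(1-5) by unfold_locales auto
  show ?thesis
    by (rule averages_tendsto_integral[OF assms(6,8,7,9)])
qed

end
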